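(* Let $n\ge 2$, write $n=2^{\alpha}N$ with $\alpha\ge0$ and $N$ odd, and let $r=2^{\alpha+2}$. Let $Q_n(x)$ be the associated polynomial of the Dynkin diagram of type $B_n$ (or $C_n$). Then $$Q_n(x)=\prod_{\substack{d\mid n\\ d\ \mathrm{odd}}}\Phi_{rd}(x),$$ where $d$ runs over the positive odd divisors of $n$ and $\Phi_k$ denotes the $k$-th cyclotomic polynomial.
   Context: Let $C$ be the $n\times n$ Cartan matrix of type $B_n$: all diagonal entries are $2$, $c_{i,i+1}=c_{i+1,i}=-1$ for $1\le i\le n-2$, $c_{n-1,n}=-2$, $c_{n,n-1}=-1$, and all other entries are $0$; the Cartan matrix of type $C_n$ is its transpose. The Coxeter adjacency matrix is $A=2I_n-C$, and $a_n(x)=\det(xI_n-A)$ is its characteristic polynomial. The associated polynomial is $Q_n(x)=x^n a_n\left(x+\frac1x\right)$, a polynomial of degree $2n$. *)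

theory Defs
  imports "Jordan_Normal_Form.Char_Poly" Complex_Main
begin

text \<open>
  Matrices from \<^theory>\<open>Jordan_Normal_Form.Matrix\<close> are indexed from 0; the entry functions
  below use indices \<open>1, \<dots>, n\<close>, hence the shift by one.
\<close>

definition cartan_B_entry :: "nat \<Rightarrow> nat \<Rightarrow> nat \<Rightarrow> int" where
  "cartan_B_entry n i j =
     (if i = j then 2
      else if i = n - 1 \<and> j = n then -2
      else if j = i + 1 \<or> i = j + 1 then -1
      else 0)"

definition cartan_B :: "nat \<Rightarrow> int mat" where
  "cartan_B n = mat n n (\<lambda>(i, j). cartan_B_entry n (i + 1) (j + 1))"

definition cartan_C :: "nat \<Rightarrow> int mat" where
  "cartan_C n = transpose_mat (cartan_B n)"

definition coxeter_adjacency :: "int mat \<Rightarrow> int mat" where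
  "coxeter_adjacency C = 2 \<cdot>\<^sub>m 1\<^sub>m (dim_row C) - C"

definition coxeter_poly :: "int mat \<Rightarrow> int poly" where
  "coxeter_poly C = char_poly (coxeter_adjacency C)"

text \<open>
  The polynomial \<open>x\<^sup>n a(x + 1/x)\<close>, with \<open>a\<close> the characteristic polynomial of degree \<open>n\<close>:
  since \<open>x\<^sup>n (x + 1/x)\<^sup>k = x\<^bsup>n-k\<^esup> (x\<^sup>2 + 1)\<^sup>k\<close> for \<open>k \<le> n\<close>, it is written without
  denominators. The lemmas \<open>poly_associated_poly\<close> and \<open>associated_poly_unique\<close>
  show that it is the only polynomial that agrees with \<open>x\<^sup>n a(x + 1/x)\<close> at all \<open>x \<noteq> 0\<close>.
\<close>

definition associated_poly :: "int mat \<Rightarrow> int poly" where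
  "associated_poly C =
     (\<Sum>k\<le>dim_row C. Polynomial.smult (coeff (coxeter_poly C) k)
        ([:0, 1:] ^ (dim_row C - k) * [:1, 0, 1:] ^ k))"

definition primitive_root_of_unity :: "nat \<Rightarrow> complex \<Rightarrow> bool" where
  "primitive_root_of_unity k z \<longleftrightarrow>
     0 < k \<and> z ^ k = 1 \<and> (\<forall>m. 0 < m \<and> m < k \<longrightarrow> z ^ m \<noteq> 1)"

definition cyclotomic :: "nat \<Rightarrow> complex poly" where
  "cyclotomic k = (\<Prod>z | primitive_root_of_unity k z. [:- z, 1:])"

lemma coxeter_adjacency_carrier:
  assumes "C \<in> carrier_mat n n"
  shows "coxeter_adjacency C \<in> carrier_mat n n"
  using assms by (auto simp: coxeter_adjacency_def)

lemma degree_coxeter_poly: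
  assumes "C \<in> carrier_mat n n"
  shows "degree (coxeter_poly C) = n"
  using degree_monic_char_poly[OF coxeter_adjacency_carrier[OF assms]]
  by (simp add: coxeter_poly_def)

lemma poly_associated_poly:
  fixes x :: complex
  assumes C: "C \<in> carrier_mat n n" and x: "x \<noteq> 0"
  shows "poly (map_poly of_int (associated_poly C)) x =
           x ^ n * poly (map_poly of_int (coxeter_poly C)) (x + 1 / x)"
proof -
  have n: "dim_row C = n" using C by auto
  interpret h: map_poly_comm_ring_hom "of_int :: int \<Rightarrow> complex" ..
  have pw: "x ^ (n - k) * (1 + x * x) ^ k = x ^ n * (x + 1 / x) ^ k" if "k \<le> n" for k
  proof -
    have "x ^ n = x ^ (n - k) * x ^ k"
      using that by (simp flip: power_add)
    moreover have "x ^ k * (x + 1 / x) ^ k = (1 + x * x) ^ k"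
      using x by (simp flip: power_mult_distrib add: algebra_simps)
    ultimately show ?thesis by (simp add: mult.assoc)
  qed
  have "poly (map_poly of_int (associated_poly C)) x =
      (\<Sum>k\<le>n. of_int (coeff (coxeter_poly C) k) * (x ^ (n - k) * (1 + x * x) ^ k))"
    by (simp add: associated_poly_def n poly_sum hom_distribs)
  also have "\<dots> = (\<Sum>k\<le>n. x ^ n * (of_int (coeff (coxeter_poly C) k) * (x + 1 / x) ^ k))"
    by (intro sum.cong) (auto simp: pw)
  also have "\<dots> = x ^ n * poly (map_poly of_int (coxeter_poly C)) (x + 1 / x)"
    by (simp add: poly_altdef sum_distrib_left degree_coxeter_poly[OF C])
  finally show ?thesis .
qed

lemma associated_poly_unique:
  fixes q :: "complex poly"
  assumes C: "C \<in> carrier_mat n n"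
    and q: "\<And>x. x \<noteq> 0 \<Longrightarrow>
      poly q x = x ^ n * poly (map_poly of_int (coxeter_poly C)) (x + 1 / x)"
  shows "q = map_poly of_int (associated_poly C)"
proof (rule ccontr)
  let ?d = "q - map_poly of_int (associated_poly C)"
  assume "q \<noteq> map_poly of_int (associated_poly C)"
  then have "finite {x. poly ?d x = 0}" by (intro poly_roots_finite) simp
  moreover have "- {0} \<subseteq> {x. poly ?d x = 0}"
    using q poly_associated_poly[OF C] by auto
  ultimately have "finite (- {0 :: complex})" by (rule rev_finite_subset)
  then show False by (simp add: finite_compl infinite_UNIV_char_0)
qed

end

theory Submission
  imports Defs "HOL-Computational_Algebra.Fundamental_Theorem_Algebra"
begin

text \<open>
  Expanding determinants along the first row gives \<open>a\<^bsub>m+3\<^esub> = x a\<^bsub>m+2\<^esub> - a\<^bsub>m+1\<^esub>\<close> with \<open>a\<^sub>1 = x\<close> and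
  \<open>a\<^sub>2 = x\<^sup>2 - 2\<close>, a recurrence that \<open>x\<^sup>m + x\<^bsup>-m\<^esup>\<close> satisfies in the variable \<open>x + 1/x\<close>. Hence
  \<open>Q\<^sub>n = x\<^bsup>2n\<^esup> + 1\<close>, whose roots are simple. They are the \<open>4n\<close>-th roots of unity that are not
  \<open>2n\<close>-th roots of unity; as \<open>4n = rN\<close> and \<open>2n = (r/2)N\<close>, their orders are the \<open>rd\<close> with
  \<open>d\<close> dividing \<open>N\<close>.
\<close>

text \<open>Only the first row and column must be sparse. The recurrence can therefore peel off the
  simply laced end while the double bond stays in the lower right corner.\<close>

lemma det_tridiagonal_expansion:
  fixes A :: "'a :: comm_ring_1 mat"
  assumes A: "A \<in> carrier_mat (Suc (Suc m)) (Suc (Suc m))"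
    and row: "\<And>j. 2 \<le> j \<Longrightarrow> j < Suc (Suc m) \<Longrightarrow> A $$ (0, j) = 0"
    and col: "\<And>i. 2 \<le> i \<Longrightarrow> i < Suc (Suc m) \<Longrightarrow> A $$ (i, 0) = 0"
  shows "det A = A $$ (0, 0) * det (mat_delete A 0 0)
    - A $$ (0, 1) * A $$ (1, 0) * det (mat_delete (mat_delete A 0 0) 0 0)"
proof -
  let ?B = "mat_delete A 0 1"
  have B: "?B \<in> carrier_mat (Suc m) (Suc m)"
    using mat_delete_carrier[OF A] by simp
  have "det A = (\<Sum>j<Suc (Suc m). A $$ (0, j) * cofactor A 0 j)"
    by (rule laplace_expansion_row[OF A]) simp
  also have "\<dots> = (\<Sum>j\<in>{0, 1}. A $$ (0, j) * cofactor A 0 j)"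
    using row by (intro sum.mono_neutral_right) (auto simp: not_less_eq_eq)
  finally have 1: "det A = A $$ (0, 0) * det (mat_delete A 0 0) - A $$ (0, 1) * det ?B"
    by (simp add: cofactor_def)
  \<comment> \<open>Column 0 of \<open>?B\<close> is column 0 of \<open>A\<close> without its top
    entry, so \<open>A $$ (1, 0)\<close> is the only entry that survives.\<close>
  have "det ?B = (\<Sum>i<Suc m. ?B $$ (i, 0) * cofactor ?B i 0)"
    by (rule laplace_expansion_column[OF B]) simp
  also have "\<dots> = (\<Sum>i\<in>{0}. ?B $$ (i, 0) * cofactor ?B i 0)"
    using col A by (intro sum.mono_neutral_right) (auto simp: mat_delete_def)
  also have "\<dots> = A $$ (1, 0) * det (mat_delete ?B 0 0)"
    using A by (simp add: cofactor_def mat_delete_def)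
  also have "mat_delete ?B 0 0 = mat_delete (mat_delete A 0 0) 0 0"
    using A by (intro eq_matI) (auto simp: mat_delete_def)
  finally show ?thesis using 1 by (simp add: mult.assoc)
qed

lemma cartan_B_carrier: "cartan_B n \<in> carrier_mat n n"
  by (simp add: cartan_B_def)

text \<open>Reduces type C to type B.\<close>

lemma coxeter_poly_transpose:
  assumes "C \<in> carrier_mat n n"
  shows "coxeter_poly (transpose_mat C) = coxeter_poly C"
proof -
  have "coxeter_adjacency (transpose_mat C) = transpose_mat (coxeter_adjacency C)"
    using assms by (intro eq_matI) (auto simp: coxeter_adjacency_def)
  then show ?thesis
    using char_poly_transpose_mat[OF coxeter_adjacency_carrier[OF assms]]
    by (simp add: coxeter_poly_def)
qed

lemma associated_poly_cartan_C: "associated_poly (cartan_C n) = associated_poly (cartan_B n)"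
  using coxeter_poly_transpose[OF cartan_B_carrier, of n] cartan_B_carrier[of n]
  by (simp add: associated_poly_def cartan_C_def)

text \<open>The diagonal of 2I - C vanishes, and the two sign changes in xI - (2I - C) cancel off
  the diagonal.\<close>

lemma char_poly_matrix_cartan_B:
  "char_poly_matrix (coxeter_adjacency (cartan_B n)) = mat n n (\<lambda>(i, j).
     if i = j then [:0, 1:] else [:cartan_B_entry n (i + 1) (j + 1):])"
  by (intro eq_matI)
    (auto simp: char_poly_matrix_def coxeter_adjacency_def cartan_B_def cartan_B_entry_def)

lemma coxeter_poly_cartan_B_0: "coxeter_poly (cartan_B 0) = 1"
  by (simp add: coxeter_poly_def char_poly_def char_poly_matrix_cartan_B)

lemma coxeter_poly_cartan_B_1: "coxeter_poly (cartan_B 1) = [:0, 1:]"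
  by (simp add: coxeter_poly_def char_poly_def char_poly_matrix_cartan_B det_single)

text \<open>The subtracted factor is the product of the two entries joining the first two nodes:
  (-1)(-1) = 1 in general, but (-2)(-1) = 2 for m = 0, where these nodes carry the double
  bond.\<close>

lemma coxeter_poly_cartan_B_Suc_Suc:
  "coxeter_poly (cartan_B (Suc (Suc m))) = [:0, 1:] * coxeter_poly (cartan_B (Suc m))
     - (if m = 0 then 2 else 1) * coxeter_poly (cartan_B m)"
proof -
  define M where "M k = char_poly_matrix (coxeter_adjacency (cartan_B k))" for k
  have det_M: "coxeter_poly (cartan_B k) = det (M k)" for k
    by (simp add: M_def coxeter_poly_def char_poly_def)
  have M: "M k = mat k k (\<lambda>(i, j).
     if i = j then [:0, 1:] else [:cartan_B_entry k (i + 1) (j + 1):])" for k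
    unfolding M_def by (rule char_poly_matrix_cartan_B)
  have shift: "cartan_B_entry (Suc k) (Suc i) (Suc j) = cartan_B_entry k i j" if "i > 0" for k i j
    using that by (simp add: cartan_B_entry_def) presburger
  have del: "mat_delete (M (Suc k)) 0 0 = M k" for k
    by (intro eq_matI) (simp_all add: M mat_delete_def shift)
  let ?A = "M (Suc (Suc m))"
  have entries: "?A $$ (0, 0) = [:0, 1:]" "?A $$ (0, 1) * ?A $$ (1, 0) = (if m = 0 then 2 else 1)"
    by (simp_all add: M cartan_B_entry_def numeral_poly)
  have "det ?A = ?A $$ (0, 0) * det (mat_delete ?A 0 0)
      - ?A $$ (0, 1) * ?A $$ (1, 0) * det (mat_delete (mat_delete ?A 0 0) 0 0)"
    by (rule det_tridiagonal_expansion[where m = m]) (simp_all add: M cartan_B_entry_def)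
  then show ?thesis
    by (simp only: det_M del entries)
qed

text \<open>The index starts at 1 because the formula would give 2 at 0, whereas the empty
  determinant is 1. The factor 2 in the recurrence for \<open>cartan_B 2\<close> makes up for
  this.\<close>

lemma poly_coxeter_poly_cartan_B:
  fixes x :: complex
  assumes "x \<noteq> 0"
  shows "poly (map_poly of_int (coxeter_poly (cartan_B (Suc m)))) (x + 1 / x) =
           x ^ Suc m + 1 / x ^ Suc m"
proof (induction m rule: induct_nat_012)
  case 0
  then show ?case by (simp add: coxeter_poly_cartan_B_1[simplified])
next
  case 1
  then show ?case using assms
    by (simp add: coxeter_poly_cartan_B_Suc_Suc coxeter_poly_cartan_B_1[simplified]
        coxeter_poly_cartan_B_0 hom_distribs field_simps)
next
  case (ge2 m)
  show ?case using assms ge2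
    by (subst coxeter_poly_cartan_B_Suc_Suc) (simp add: hom_distribs field_simps)
qed

lemma associated_poly_cartan_B:
  assumes "n > 0"
  shows "map_poly of_int (associated_poly (cartan_B n)) = (monom 1 (2 * n) + 1 :: complex poly)"
proof (rule associated_poly_unique[OF cartan_B_carrier, symmetric])
  fix x :: complex
  assume "x \<noteq> 0"
  moreover have "x ^ (2 * n) = x ^ n * x ^ n" by (simp add: mult_2 power_add)
  ultimately show "poly (monom 1 (2 * n) + 1) x =
      x ^ n * poly (map_poly of_int (coxeter_poly (cartan_B n))) (x + 1 / x)"
    using poly_coxeter_poly_cartan_B[of x "n - 1"] assms
    by (simp add: poly_monom distrib_left)
qed

lemma monom_add_one_eq_prod_roots:
  assumes "k > 0"
  shows "(monom 1 k + 1 :: complex poly) = (\<Prod>z | z ^ k = -1. [:- z, 1:])"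
proof -
  let ?p = "monom 1 k + 1 :: complex poly"
  have root: "poly ?p z = 0 \<longleftrightarrow> z ^ k = -1" for z
    by (simp add: poly_monom eq_neg_iff_add_eq_0)
  have "rsquarefree ?p"
    unfolding rsquarefree_roots
  proof (intro allI notI)
    fix z assume z: "poly ?p z = 0 \<and> poly (pderiv ?p) z = 0"
    then have "z ^ k = -1" using root by blast
    \<comment> \<open>The derivative k z^(k-1) has no zero other than 0.\<close>
    moreover have "z = 0"
      using z assms by (auto simp: pderiv_add pderiv_monom poly_monom)
    ultimately show False using assms by (simp add: power_0_left)
  qed
  moreover have "degree ?p = k"
    using assms by (subst degree_add_eq_left) (auto simp: degree_monom_eq)
  then have "lead_coeff ?p = 1"
    using assms by simp
  ultimately show ?thesis
    using complex_poly_decompose_rsquarefree[of ?p] by (simp only: root smult_1_left)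
qed

text \<open>Reduce the exponent modulo k: by minimality of k, a remainder below k gives 1 only if it
  is 0.\<close>

lemma primitive_root_of_unity_power_eq_one_iff:
  assumes "primitive_root_of_unity k z"
  shows "z ^ m = 1 \<longleftrightarrow> k dvd m"
proof -
  have k: "0 < k" "z ^ k = 1" "\<And>m. 0 < m \<Longrightarrow> m < k \<Longrightarrow> z ^ m \<noteq> 1"
    using assms by (auto simp: primitive_root_of_unity_def)
  have "z ^ m = z ^ (k * (m div k) + m mod k)" by simp
  also have "\<dots> = z ^ (m mod k)"
    by (simp only: power_add power_mult k power_one mult_1)
  finally have "z ^ m = 1 \<longleftrightarrow> z ^ (m mod k) = 1" by simp
  then show ?thesis
    using k(1) k(3)[of "m mod k"] by (auto simp: dvd_eq_mod_eq_0)
qed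

lemma primitive_root_of_unity_unique:
  assumes "primitive_root_of_unity k z" "primitive_root_of_unity l z"
  shows "k = l"
proof (rule dvd_antisym)
  show "k dvd l"
    using assms(2) primitive_root_of_unity_power_eq_one_iff[OF assms(1), of l]
    by (simp add: primitive_root_of_unity_def)
  show "l dvd k"
    using assms(1) primitive_root_of_unity_power_eq_one_iff[OF assms(2), of k]
    by (simp add: primitive_root_of_unity_def)
qed

lemma primitive_root_of_unity_exists:
  assumes "z ^ m = 1" "m > 0"
  obtains k where "primitive_root_of_unity k z"
proof
  let ?P = "\<lambda>k. 0 < k \<and> z ^ k = 1"
  have "?P m" using assms by simp
  then have "?P (Least ?P)" by (rule LeastI)
  moreover have "\<not> ?P l" if "l < Least ?P" for l
    using that by (rule not_less_Least)
  ultimately show "primitive_root_of_unity (Least ?P) z"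
    unfolding primitive_root_of_unity_def by blast
qed

lemma finite_primitive_roots_of_unity: "finite {z. primitive_root_of_unity k z}"
proof (cases "k = 0")
  case False
  then show ?thesis
    by (intro finite_subset[OF _ finite_nth_roots[of k 1]])
      (auto simp: primitive_root_of_unity_def)
qed (simp add: primitive_root_of_unity_def)

text \<open>The square of z^k is 1 exactly when z^k is 1 or -1.\<close>

lemma power_eq_minus_one_iff:
  fixes z :: complex
  shows "z ^ k = -1 \<longleftrightarrow> z ^ (2 * k) = 1 \<and> z ^ k \<noteq> 1"
proof -
  have "z ^ (2 * k) = (z ^ k)\<^sup>2" by (simp only: power_mult mult.commute[of 2 k])
  then show ?thesis by (auto simp: power2_eq_1_iff)
qed

text \<open>A divisor of 2^(a+1) N fails to divide 2^a N exactly when it contains the full power of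
  two.\<close>

lemma power_two_dvd_mult_odd_iff:
  fixes k N a :: nat
  assumes "k dvd 2 ^ Suc a * N" "odd N"
  shows "k dvd 2 ^ a * N \<longleftrightarrow> \<not> 2 ^ Suc a dvd k"
proof
  assume "k dvd 2 ^ a * N"
  moreover have "\<not> 2 ^ Suc a dvd 2 ^ a * N"
    using assms(2) by (simp add: mult.commute)
  ultimately show "\<not> 2 ^ Suc a dvd k" by (blast intro: dvd_trans)
next
  assume not_dvd: "\<not> 2 ^ Suc a dvd k"
  \<comment> \<open>Split k into a power of two and a divisor of N; it remains to exclude the top
    exponent.\<close>
  obtain u v where k: "k = u * v" and u: "u dvd 2 ^ Suc a" and v: "v dvd N"
    using assms(1) by (blast dest: division_decomp)
  obtain i where i: "i \<le> Suc a" "u = 2 ^ i"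
    using u by (auto simp: divides_primepow_nat simp del: power_Suc)
  then have "i \<noteq> Suc a" using not_dvd k by auto
  then show "k dvd 2 ^ a * N"
    using i v k by (auto intro!: mult_dvd_mono le_imp_power_dvd)
qed

text \<open>The order of z divides 2^(a+1) N but not 2^a N, hence is 2^(a+1) times a divisor of
  N.\<close>

lemma power_eq_minus_one_iff_primitive_root:
  fixes z :: complex
  assumes "odd N" "N > 0"
  shows "z ^ (2 ^ a * N) = -1 \<longleftrightarrow>
    (\<exists>d. d dvd N \<and> primitive_root_of_unity (2 ^ Suc a * d) z)"
proof
  assume L: "z ^ (2 ^ a * N) = -1"
  then have 1: "z ^ (2 ^ Suc a * N) = 1" "z ^ (2 ^ a * N) \<noteq> 1"
    by (auto simp: power_eq_minus_one_iff mult.assoc)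
  then obtain k where k: "primitive_root_of_unity k z"
    using assms(2) by (auto elim: primitive_root_of_unity_exists)
  then have kd: "k dvd 2 ^ Suc a * N" and "2 ^ Suc a dvd k"
    using 1 power_two_dvd_mult_odd_iff[of k a N] assms(1)
    by (auto simp: primitive_root_of_unity_power_eq_one_iff)
  then obtain d where "k = 2 ^ Suc a * d" by blast
  then show "\<exists>d. d dvd N \<and> primitive_root_of_unity (2 ^ Suc a * d) z"
    using k kd by (intro exI[of _ d]) simp
next
  assume "\<exists>d. d dvd N \<and> primitive_root_of_unity (2 ^ Suc a * d) z"
  then obtain d where d: "d dvd N" "primitive_root_of_unity (2 ^ Suc a * d) z" by blast
  have "2 ^ Suc a * d dvd 2 ^ Suc a * N" using d(1) by (rule mult_dvd_mono[OF dvd_refl])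
  moreover from this have "\<not> 2 ^ Suc a * d dvd 2 ^ a * N"
    using power_two_dvd_mult_odd_iff[OF _ assms(1)] by simp
  ultimately show "z ^ (2 ^ a * N) = -1"
    using primitive_root_of_unity_power_eq_one_iff[OF d(2)]
    by (subst power_eq_minus_one_iff) (simp add: mult.assoc)
qed

text \<open>Group the linear factors by the order of the root.\<close>

lemma monom_add_one_eq_prod_cyclotomic:
  assumes "odd N" "N > 0"
  shows "(monom 1 (2 ^ a * N) + 1 :: complex poly) = (\<Prod>d | d dvd N. cyclotomic (2 ^ Suc a * d))"
proof -
  let ?R = "\<lambda>d. {z. primitive_root_of_unity (2 ^ Suc a * d) z}"
  have "{z :: complex. z ^ (2 ^ a * N) = -1} = (\<Union>d\<in>{d. d dvd N}. ?R d)"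
    by (simp only: power_eq_minus_one_iff_primitive_root[OF assms]) blast
  then have "(monom 1 (2 ^ a * N) + 1 :: complex poly) =
      (\<Prod>z\<in>(\<Union>d\<in>{d. d dvd N}. ?R d). [:- z, 1:])"
    using monom_add_one_eq_prod_roots[of "2 ^ a * N"] assms(2) by simp
  also have "\<dots> = (\<Prod>d | d dvd N. \<Prod>z\<in>?R d. [:- z, 1:])"
  proof (rule prod.UNION_disjoint)
    \<comment> \<open>A number has only one order, and the common factor 2^(a+1) cancels.\<close>
    have "d = d'" if "z \<in> ?R d" "z \<in> ?R d'" for d d' z
      using primitive_root_of_unity_unique[of "2 ^ Suc a * d" z "2 ^ Suc a * d'"] that by simp
    then show "\<forall>d\<in>{d. d dvd N}. \<forall>d'\<in>{d. d dvd N}. d \<noteq> d' \<longrightarrow> ?R d \<inter> ?R d' = {}"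
      by blast
  qed (use assms(2) in \<open>simp_all only: finite_primitive_roots_of_unity finite_divisors_nat simp_thms ball_triv\<close>)
  finally show ?thesis unfolding cyclotomic_def .
qed

theorem proposition9:
  fixes n \<alpha> N r :: nat
  assumes "n \<ge> 2"
    and "n = 2 ^ \<alpha> * N"
    and "odd N"
    and "r = 2 ^ (\<alpha> + 2)"
  shows "map_poly of_int (associated_poly (cartan_B n)) =
           (\<Prod>d | d dvd n \<and> odd d. cyclotomic (r * d)) \<and>
         map_poly of_int (associated_poly (cartan_C n)) =
           (\<Prod>d | d dvd n \<and> odd d. cyclotomic (r * d))"
proof -
  \<comment> \<open>An odd divisor of n is coprime to 2^\<alpha>, so it divides N.\<close>
  have "{d. d dvd n \<and> odd d} = {d. d dvd N}"
    using assms(2,3) by (auto simp: coprime_dvd_mult_right_iff)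
  moreover have "(monom 1 (2 * n) + 1 :: complex poly) = (\<Prod>d | d dvd N. cyclotomic (r * d))"
    \<comment> \<open>The exponent is 2n = 2^(\<alpha>+1) N, so the orders carry the factor
      2^(\<alpha>+2) = r.\<close>
    using monom_add_one_eq_prod_cyclotomic[of N "Suc \<alpha>"] assms
    by (simp add: mult.assoc odd_pos)
  ultimately show ?thesis
    using assms(1) by (simp add: associated_poly_cartan_C associated_poly_cartan_B)
qed

end
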